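(* Let $n \ge 2$ be an integer and let $D$ be the distance matrix of an unweighted metric tree on $n+1$ vertices. Then \[ \langle D^{-1}\mathbf{1}, \mathbf{1}\rangle = \frac{2}{n}. \]
   Context: An unweighted metric tree on $n+1$ vertices is a tree (connected acyclic finite graph) with vertices $v_0,\ldots,v_n$ whose vertex set is endowed with the usual graph metric $\rho$ ($\rho(v_i,v_j)$ is the number of edges on the path from $v_i$ to $v_j$). Its distance matrix is the $(n+1)\times(n+1)$ matrix $D = (\rho(v_i,v_j))_{i,j=0}^n$; it is invertible by the Graham–Pollak formula $\det(D) = (-1)^n n 2^{n-1}$. $\mathbf{1}\in\mathbb{R}^{n+1}$ is the column vector all of whose coordinates are $1$, and $\langle\cdot,\cdot\rangle$ is the standard real inner product. *)

theory Defs
  imports "HOL-Analysis.Analysis" "Graph_Theory.Graph_Theory"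
begin

text \<open>
  The locale \<^locale>\<open>graph\<close> describes finite simple undirected graphs: every edge is a pair of
  opposite arcs. The constant \<^const>\<open>Digraph_Component.tree\<close> is unsuitable here, since
  its acyclicity refers to directed cycles, and an edge traversed back and forth is one of these.
  A cycle of the undirected graph is a directed cycle of length at least 3.
\<close>

definition undirected_tree :: "('a, 'b) pre_digraph \<Rightarrow> bool" where
  "undirected_tree G \<longleftrightarrow>
     graph G \<and> Digraph_Component.connected G \<and> (\<nexists>p. pre_digraph.cycle G p \<and> 3 \<le> length p)"

text \<open>
  The library's shortest-path distance, every edge having weight 1. In a connected graph it is
  finite, so the conversion to \<^typ>\<open>real\<close> loses nothing.
\<close>

definition graph_dist :: "('a, 'b) pre_digraph \<Rightarrow> 'a \<Rightarrow> 'a \<Rightarrow> real" where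
  "graph_dist G u w = real_of_ereal (wf_digraph.\<mu> G (\<lambda>_. 1) u w)"

text \<open>The function \<open>v\<close> enumerates the vertices of \<open>G\<close> by the matrix indices.\<close>

definition distance_matrix :: "('a, 'b) pre_digraph \<Rightarrow> ('i::finite \<Rightarrow> 'a) \<Rightarrow> real ^ 'i ^ 'i" where
  "distance_matrix G v = (\<chi> i j. graph_dist G (v i) (v j))"

end

theory Submission
  imports Defs
begin

text \<open>
  Let \<open>L\<close> be the graph Laplacian and \<open>w = 2 - deg\<close>. Seen from a root \<open>r\<close>, a vertex \<open>k \<noteq> r\<close> of a
  tree has exactly one neighbour that is closer to \<open>r\<close>, and all its other neighbours are one step
  further away. Hence \<open>D L = 1 w\<^sup>T - 2 I\<close>, \<open>1\<^sup>T w = 2\<close> and \<open>D w = n 1\<close>. It follows that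
  \<open>D\<^sup>-\<^sup>1 = (w w\<^sup>T / n - L) / 2\<close>; since \<open>L 1 = 0\<close>, we get \<open>D\<^sup>-\<^sup>1 1 = w / n\<close>, whose coordinates sum
  to \<open>2 / n\<close>.
\<close>

section \<open>Distances in a tree\<close>

lemma (in wf_digraph) awalk_avoiding:
  assumes "(a, b) \<in> {(x, y). x \<rightarrow>\<^bsub>G\<^esub> y \<and> x \<noteq> k \<and> y \<noteq> k}\<^sup>*" "a \<in> verts G" "a \<noteq> k"
  shows "\<exists>p. awalk a p b \<and> k \<notin> set (awalk_verts a p)"
  using assms
proof (induction rule: converse_rtrancl_induct)
  case base
  then show ?case by (intro exI[of _ "[]"]) (simp add: awalk_Nil_iff)
next
  case (step x y)
  then obtain e where e: "e \<in> arcs G" "tail G e = x" "head G e = y" by auto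
  with step obtain p where "awalk y p b" "k \<notin> set (awalk_verts y p)"
    by auto
  with e step show ?case
    by (intro exI[of _ "e # p"]) (auto simp: awalk_Cons_iff)
qed

text \<open>A walk from \<open>a\<close> to \<open>b\<close> that avoids \<open>k\<close> shortens
  to a path with at least one arc, as \<open>a\<close> and \<open>b\<close> differ. The arcs from
  \<open>k\<close> to \<open>a\<close> and from \<open>b\<close> to \<open>k\<close> close it to a
  cycle of length at least 3.\<close>

lemma (in wf_digraph) cycle_through_vertex:
  assumes "k \<rightarrow>\<^bsub>G\<^esub> a" "b \<rightarrow>\<^bsub>G\<^esub> k" "a \<noteq> b" "a \<noteq> k"
    and "(a, b) \<in> {(x, y). x \<rightarrow>\<^bsub>G\<^esub> y \<and> x \<noteq> k \<and> y \<noteq> k}\<^sup>*"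
  shows "\<exists>p. cycle p \<and> 3 \<le> length p"
proof -
  have "a \<in> verts G" using assms(1) by (rule adj_in_verts)
  then obtain q where q: "awalk a q b" "k \<notin> set (awalk_verts a q)"
    using awalk_avoiding assms by blast
  define p where "p = awalk_to_apath q"
  have p: "awalk a p b" "distinct (awalk_verts a p)"
    using apath_awalk_to_apath[OF q(1)] by (auto simp: p_def apath_def)
  have "set p \<subseteq> set q"
    using awalk_to_apath_subset[OF q(1)] by (simp add: p_def)
  then have kp: "k \<notin> set (awalk_verts a p)"
    using q p(1) by (auto simp: set_awalk_verts)
  obtain e where e: "e \<in> arcs G" "tail G e = k" "head G e = a" using assms(1) by auto
  obtain f where f: "f \<in> arcs G" "tail G f = b" "head G f = k" using assms(2) by auto
  have "p \<noteq> []" using p(1) assms(3) by (auto simp: awalk_Nil_iff)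
  have af: "awalk a (p @ [f]) k"
    using awalk_appendI[OF p(1), of "[f]" k] arc_implies_awalk[OF f(1)]
    unfolding f(2,3) by blast
  have "awalk k (e # p @ [f]) k"
    using e af unfolding awalk_Cons_iff by blast
  moreover have "awalk_verts a (p @ [f]) = awalk_verts a p @ [k]"
    using awalk_verts_append[OF af] f by simp
  \<comment> \<open>Dropping the head removes one of the two occurrences of \<open>k\<close>, the
    start and the end of the closed walk.\<close>
  then have "distinct (tl (awalk_verts k (e # p @ [f])))"
    using e p kp by simp
  moreover have "3 \<le> length (e # p @ [f])"
    using \<open>p \<noteq> []\<close> by (cases p) auto
  ultimately show ?thesis unfolding cycle_def by blast
qed

locale undirected_tree_graph = graph +
  assumes conn: "Digraph_Component.connected G"
    and no_cycle: "\<not> (\<exists>p. cycle p \<and> 3 \<le> length p)"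
begin

section \<open>Distances from a root\<close>

lemma adj_sym: "u \<rightarrow>\<^bsub>G\<^esub> v \<Longrightarrow> v \<rightarrow>\<^bsub>G\<^esub> u"
  using sym_arcs by (rule arcs_ends_symmetric)

lemma reach: "u \<in> verts G \<Longrightarrow> v \<in> verts G \<Longrightarrow> u \<rightarrow>\<^sup>* v"
  using symmetric_connected_imp_strongly_connected[OF sym_arcs conn] by auto

text \<open>The infimum over walks is attained, and with unit costs its value is the length of a
  walk. That distances are natural numbers is what later turns strict inequalities between them into
  gaps of 1.\<close>

lemma \<mu>_eq_graph_dist:
  assumes "u \<in> verts G" "v \<in> verts G"
  shows "\<mu> (\<lambda>_. 1) u v = ereal (graph_dist G u v)" and "graph_dist G u v \<in> \<nat>"
proof -
  obtain p where p: "\<mu> (\<lambda>_. 1) u v = awalk_cost (\<lambda>_. 1) p"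
    using min_cost_awalk[OF reach[OF assms], of "\<lambda>_. 1"] by auto
  then have "graph_dist G u v = awalk_cost (\<lambda>_. 1) p"
    by (simp add: graph_dist_def)
  with p show "\<mu> (\<lambda>_. 1) u v = ereal (graph_dist G u v)" "graph_dist G u v \<in> \<nat>"
    by (simp_all add: awalk_cost_def sum_list_triv)
qed

lemma graph_dist_refl:
  assumes "r \<in> verts G"
  shows "graph_dist G r r = 0"
proof -
  have "ereal (graph_dist G r r) \<le> ereal 0"
    using min_cost_le_walk_cost[of r "[]" r "\<lambda>_. 1"] assms
    by (simp add: \<mu>_eq_graph_dist awalk_Nil_iff)
  moreover have "graph_dist G r r \<ge> 0"
    using \<mu>_eq_graph_dist(2)[OF assms assms] by (auto elim: Nats_cases)
  ultimately show ?thesis by simp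
qed

lemma graph_dist_adj_le:
  assumes "r \<in> verts G" "u \<rightarrow>\<^bsub>G\<^esub> v"
  shows "graph_dist G r v \<le> graph_dist G r u + 1"
proof -
  obtain e where "e \<in> arcs G" "arc_to_ends G e = (u, v)"
    using assms(2) by (auto simp: arcs_ends_def)
  then have "\<mu> (\<lambda>_. 1) r v \<le> \<mu> (\<lambda>_. 1) r u + ereal 1"
    using pos_cost_mu_triangle[of "\<lambda>_. 1" e u v r] by simp
  then show ?thesis
    using assms adj_in_verts[OF assms(2)] by (simp add: \<mu>_eq_graph_dist)
qed

text \<open>The neighbour is the last vertex before \<open>v\<close> on a shortest walk from
  \<open>r\<close>.\<close>

lemma closer_neighbour:
  assumes "r \<in> verts G" "v \<in> verts G" "v \<noteq> r"
  shows "\<exists>u. v \<rightarrow>\<^bsub>G\<^esub> u \<and> graph_dist G r u = graph_dist G r v - 1"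
proof -
  obtain u e where ue: "\<mu> (\<lambda>_. 1) r v = \<mu> (\<lambda>_. 1) r u + ereal 1" "arc e (u, v)"
    using mu_exact_triangle[of v r "\<lambda>_. 1"] assms reach by auto
  then have "u \<rightarrow>\<^bsub>G\<^esub> v"
    unfolding arc_def by (auto simp: arcs_ends_conv)
  moreover from this have "u \<in> verts G" by (rule adj_in_verts)
  then have "graph_dist G r u = graph_dist G r v - 1"
    using ue(1) assms by (simp add: \<mu>_eq_graph_dist)
  ultimately show ?thesis using adj_sym by blast
qed

lemma graph_dist_eq_0_iff:
  assumes "r \<in> verts G" "v \<in> verts G"
  shows "graph_dist G r v = 0 \<longleftrightarrow> v = r"
proof
  assume "graph_dist G r v = 0"
  show "v = r"
  proof (rule ccontr)
    assume "v \<noteq> r"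
    then obtain u where u: "v \<rightarrow>\<^bsub>G\<^esub> u" "graph_dist G r u = graph_dist G r v - 1"
      using closer_neighbour assms by blast
    have "graph_dist G r u \<ge> 0"
      using \<mu>_eq_graph_dist(2)[OF assms(1) adj_in_verts(2)[OF u(1)]] by (auto elim: Nats_cases)
    with u \<open>graph_dist G r v = 0\<close> show False by simp
  qed
qed (simp add: graph_dist_refl assms)

section \<open>Neighbours of a vertex, seen from the root\<close>

text \<open>A geodesic to the root leaves the distance level of its starting vertex at once.\<close>

lemma geodesic_avoiding:
  assumes "r \<in> verts G" "a \<in> verts G" "a \<noteq> k" "graph_dist G r a \<le> graph_dist G r k"
  shows "(a, r) \<in> {(x, y). x \<rightarrow>\<^bsub>G\<^esub> y \<and> x \<noteq> k \<and> y \<noteq> k}\<^sup>*"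
proof -
  obtain m :: nat where "graph_dist G r a = m"
    using \<mu>_eq_graph_dist(2)[OF assms(1,2)] by (auto elim: Nats_cases)
  then show ?thesis
    using assms
  proof (induction m arbitrary: a)
    case 0
    then show ?case by (simp add: graph_dist_eq_0_iff)
  next
    case (Suc m)
    then have "a \<noteq> r" by (auto simp: graph_dist_refl)
    then obtain u where u: "a \<rightarrow>\<^bsub>G\<^esub> u" "graph_dist G r u = graph_dist G r a - 1"
      using closer_neighbour Suc.prems by blast
    \<comment> \<open>\<open>u\<close> is strictly closer to \<open>r\<close> than \<open>a\<close>,
      and \<open>a\<close> is no farther than \<open>k\<close>.\<close>
    have "u \<noteq> k" using u Suc.prems by auto
    then have "(u, r) \<in> {(x, y). x \<rightarrow>\<^bsub>G\<^esub> y \<and> x \<noteq> k \<and> y \<noteq> k}\<^sup>*"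
      using u Suc.prems adj_in_verts[OF u(1)] by (intro Suc.IH) auto
    then show ?case
      using u \<open>u \<noteq> k\<close> Suc.prems by (intro converse_rtrancl_into_rtrancl[of a u]) auto
  qed
qed

text \<open>Geodesics from \<open>a\<close> and \<open>b\<close> to \<open>r\<close> avoid
  \<open>k\<close>; joined at \<open>r\<close>, they would yield a cycle through \<open>k\<close>.
  Since the bounds are not strict, the lemma also rules out neighbours on the level of
  \<open>k\<close>.\<close>

lemma unique_closer_neighbour:
  assumes "r \<in> verts G" "k \<rightarrow>\<^bsub>G\<^esub> a" "k \<rightarrow>\<^bsub>G\<^esub> b"
    and "graph_dist G r a \<le> graph_dist G r k" "graph_dist G r b \<le> graph_dist G r k"
  shows "a = b"
proof (rule ccontr)
  assume "a \<noteq> b"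
  let ?R = "{(x, y). x \<rightarrow>\<^bsub>G\<^esub> y \<and> x \<noteq> k \<and> y \<noteq> k}"
  have ne: "a \<noteq> k" "b \<noteq> k" using assms adj_not_same by auto
  have "(a, r) \<in> ?R\<^sup>*" "(b, r) \<in> ?R\<^sup>*"
    using geodesic_avoiding assms ne adj_in_verts by blast+
  moreover have "sym (?R\<^sup>*)"
    using adj_sym by (intro sym_rtrancl) (auto simp: sym_def)
  ultimately have "(a, b) \<in> ?R\<^sup>*"
    by (meson rtrancl_trans symD)
  then show False
    using cycle_through_vertex[of k a b] assms \<open>a \<noteq> b\<close> ne adj_sym no_cycle by blast
qed

lemma farther_neighbour:
  assumes "r \<in> verts G" "k \<rightarrow>\<^bsub>G\<^esub> l" "graph_dist G r l > graph_dist G r k"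
  shows "graph_dist G r l = graph_dist G r k + 1"
proof -
  obtain m m' :: nat where "graph_dist G r l = m" "graph_dist G r k = m'"
    using \<mu>_eq_graph_dist(2) assms(1) adj_in_verts[OF assms(2)] by (meson Nats_cases)
  with graph_dist_adj_le[OF assms(1,2)] assms(3) show ?thesis by simp
qed

text \<open>Every neighbour contributes \<open>graph_dist G r k + 1\<close> except the one towards
  the root, which falls short of this by 2; the root has no such neighbour. This is the entrywise
  form of \<open>D L = 1 w^T - 2 I\<close>.\<close>

lemma sum_graph_dist_neighbours:
  assumes "r \<in> verts G" "k \<in> verts G"
  shows "(\<Sum>l | k \<rightarrow>\<^bsub>G\<^esub> l. graph_dist G r l) =
    card {l. k \<rightarrow>\<^bsub>G\<^esub> l} * (graph_dist G r k + 1) - (if k = r then 0 else 2)"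
proof -
  have fin: "finite {l. k \<rightarrow>\<^bsub>G\<^esub> l}"
    by (rule finite_subset[OF _ finite_verts]) (auto intro: adj_in_verts)
  show ?thesis
  proof (cases "k = r")
    case True
    have "graph_dist G r l = graph_dist G r k + 1" if "k \<rightarrow>\<^bsub>G\<^esub> l" for l
    proof (rule farther_neighbour[OF assms(1) that])
      have "l \<in> verts G" "l \<noteq> r"
        using that True adj_in_verts adj_not_same by auto
      then have "graph_dist G r l \<noteq> 0" "graph_dist G r l \<in> \<nat>"
        using assms \<mu>_eq_graph_dist(2) by (auto simp: graph_dist_eq_0_iff)
      then show "graph_dist G r k < graph_dist G r l"
        using True assms by (auto simp: graph_dist_refl elim!: Nats_cases)
    qed
    then show ?thesis using True by simp
  next
    case False
    then obtain p where p: "k \<rightarrow>\<^bsub>G\<^esub> p" "graph_dist G r p = graph_dist G r k - 1"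
      using closer_neighbour assms by blast
    have "graph_dist G r l = graph_dist G r k + 1" if "l \<in> {l. k \<rightarrow>\<^bsub>G\<^esub> l} - {p}" for l
    proof (rule farther_neighbour)
      show "graph_dist G r k < graph_dist G r l"
        using unique_closer_neighbour[OF assms(1) p(1), of l] that p by fastforce
    qed (use assms that in auto)
    then have "(\<Sum>l\<in>{l. k \<rightarrow>\<^bsub>G\<^esub> l} - {p}. graph_dist G r l) =
        (real (card {l. k \<rightarrow>\<^bsub>G\<^esub> l}) - 1) * (graph_dist G r k + 1)"
      using sum.remove[OF fin, of p "\<lambda>_. graph_dist G r k + 1"] p by (simp add: algebra_simps)
    then show ?thesis
      using sum.remove[OF fin, of p "graph_dist G r"] p False
      by (simp add: algebra_simps)
  qed
qed

text \<open>Adjacent vertices cannot lie on the same level: \<open>l\<close> and the neighbour of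
  \<open>k\<close> towards the root would both be no farther than \<open>k\<close>, hence equal. The
  square makes the statement symmetric in \<open>k\<close> and \<open>l\<close>.\<close>

lemma graph_dist_adj_sq:
  assumes "r \<in> verts G" "k \<rightarrow>\<^bsub>G\<^esub> l"
  shows "(graph_dist G r k - graph_dist G r l)\<^sup>2 = 1"
proof -
  have *: "(graph_dist G r u - graph_dist G r v)\<^sup>2 = 1"
    if "u \<rightarrow>\<^bsub>G\<^esub> v" "graph_dist G r u < graph_dist G r v" for u v
    using farther_neighbour[OF assms(1) that] by simp
  have "graph_dist G r k \<noteq> graph_dist G r l"
  proof
    assume eq: "graph_dist G r k = graph_dist G r l"
    have "k \<noteq> r"
      using eq assms graph_dist_eq_0_iff[of r l] graph_dist_refl[of r] adj_in_verts[OF assms(2)]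
        adj_not_same by auto
    then obtain p where p: "k \<rightarrow>\<^bsub>G\<^esub> p" "graph_dist G r p = graph_dist G r k - 1"
      using closer_neighbour assms adj_in_verts by blast
    then have "p = l"
      using assms eq by (intro unique_closer_neighbour[of r k]) auto
    with p eq show False by simp
  qed
  then consider "graph_dist G r k < graph_dist G r l" | "graph_dist G r l < graph_dist G r k"
    by linarith
  then show ?thesis
    by cases (use *[OF assms(2)] *[OF adj_sym[OF assms(2)]] in \<open>auto simp: power2_commute\<close>)
qed

end

section \<open>Inverting the distance matrix\<close>

text \<open>In the application \<open>A\<close> is the adjacency matrix and \<open>d\<close> the distance from the vertex \<open>r\<close>.\<close>

lemma sum_degree_and_distance:
  fixes A :: "real ^ 'i ^ 'i" and deg d :: "'i::finite \<Rightarrow> real"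
  assumes sym: "\<And>i j. A $ i $ j = A $ j $ i"
    and deg: "\<And>i. deg i = (\<Sum>j\<in>UNIV. A $ i $ j)"
    and d0: "d r = 0"
    and step: "\<And>i j. A $ i $ j * (d i - d j)\<^sup>2 = A $ i $ j"
    and nbrs: "\<And>i. (\<Sum>j\<in>UNIV. A $ i $ j * d j) = deg i * (d i + 1) - (if i = r then 0 else 2)"
  shows "(\<Sum>i\<in>UNIV. 2 - deg i) = 2"
    and "(\<Sum>i\<in>UNIV. d i * (2 - deg i)) = real CARD('i) - 1"
proof -
  have swap: "(\<Sum>i\<in>UNIV. \<Sum>j\<in>UNIV. A $ i $ j * f j) = (\<Sum>j\<in>UNIV. deg j * f j)" for f
  proof -
    have "(\<Sum>i\<in>UNIV. \<Sum>j\<in>UNIV. A $ i $ j * f j) = (\<Sum>j\<in>UNIV. \<Sum>i\<in>UNIV. A $ i $ j * f j)"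
      by (rule sum.swap)
    also have "\<dots> = (\<Sum>j\<in>UNIV. deg j * f j)"
      by (simp add: deg sum_distrib_right sym)
    finally show ?thesis .
  qed
  have root: "(\<Sum>i\<in>UNIV. if i = r then 0 else (2::real)) = 2 * (real CARD('i) - 1)"
  proof -
    have "(\<Sum>i\<in>UNIV. if i = r then 0 else (2::real)) = (\<Sum>i\<in>UNIV. 2 - (if i = r then 2 else 0))"
      by (intro sum.cong) auto
    then show ?thesis by (simp add: sum_subtractf)
  qed
  \<comment> \<open>Summing \<open>nbrs\<close> over all \<open>i\<close> and exchanging the sums
    leaves \<open>deg i * d i\<close> on both sides. After cancellation, the degrees add up to twice
    \<open>CARD('i) - 1\<close>.\<close>
  have "(\<Sum>i\<in>UNIV. deg i * d i) =
      (\<Sum>i\<in>UNIV. deg i * (d i + 1) - (if i = r then 0 else 2))"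
    using swap[of d] by (simp only: nbrs)
  then have degsum: "(\<Sum>i\<in>UNIV. deg i) = 2 * (real CARD('i) - 1)"
    by (simp add: sum_subtractf sum.distrib distrib_left root)
  then show "(\<Sum>i\<in>UNIV. 2 - deg i) = 2"
    by (simp add: sum_subtractf)
  \<comment> \<open>By \<open>step\<close>, the degree sum is also the sum of squared differences
    over adjacent pairs. When the squares are expanded, the terms in
    \<open>deg i * (d i)\<^sup>2\<close> cancel and twice the wanted sum remains.\<close>
  have "(\<Sum>i\<in>UNIV. deg i) = (\<Sum>i\<in>UNIV. \<Sum>j\<in>UNIV. A $ i $ j * (d i - d j)\<^sup>2)"
    by (simp add: step deg)
  also have "\<dots> = (\<Sum>i\<in>UNIV. \<Sum>j\<in>UNIV. A $ i $ j * (d i)\<^sup>2)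
      + (\<Sum>i\<in>UNIV. \<Sum>j\<in>UNIV. A $ i $ j * (d j)\<^sup>2)
      - (\<Sum>i\<in>UNIV. 2 * d i * (\<Sum>j\<in>UNIV. A $ i $ j * d j))"
    by (simp add: sum.distrib[symmetric] sum_subtractf[symmetric] sum_distrib_left
        power2_eq_square algebra_simps)
  also have "\<dots> = 2 * (\<Sum>i\<in>UNIV. deg i * (d i)\<^sup>2)
      - (\<Sum>i\<in>UNIV. 2 * d i * (deg i * (d i + 1) - (if i = r then 0 else 2)))"
    by (simp add: swap nbrs deg sum_distrib_right)
  \<comment> \<open>The exception at \<open>r\<close> disappears because its factor
    \<open>d r\<close> is 0.\<close>
  also have "(\<Sum>i\<in>UNIV. 2 * d i * (deg i * (d i + 1) - (if i = r then 0 else 2))) =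
      (\<Sum>i\<in>UNIV. 2 * (deg i * (d i)\<^sup>2) - 2 * (d i * (2 - deg i)))"
    by (intro sum.cong) (auto simp: d0 power2_eq_square algebra_simps)
  also have "\<dots> = 2 * (\<Sum>i\<in>UNIV. deg i * (d i)\<^sup>2) - 2 * (\<Sum>i\<in>UNIV. d i * (2 - deg i))"
    by (simp add: sum_subtractf sum_distrib_left)
  finally show "(\<Sum>i\<in>UNIV. d i * (2 - deg i)) = real CARD('i) - 1"
    using degsum by simp
qed

text \<open>\<open>matrix_inv\<close> chooses some two-sided inverse. For square matrices a right
  inverse is two-sided, and then the choice is unique.\<close>

lemma matrix_inv_eqI:
  fixes A B :: "real ^ 'n ^ 'n"
  assumes "A ** B = mat 1"
  shows "matrix_inv A = B"
proof -
  have "B ** A = mat 1" using assms matrix_left_right_inverse by blast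
  then have "A ** matrix_inv A = mat 1"
    using someI[of "\<lambda>C. A ** C = mat 1 \<and> C ** A = mat 1" B] assms
    by (simp add: matrix_inv_def)
  then show ?thesis
    by (metis \<open>B ** A = mat 1\<close> matrix_mul_assoc matrix_mul_lid matrix_mul_rid)
qed

lemma inner_matrix_inv_distance_one:
  fixes A D :: "real ^ 'i ^ 'i" and deg :: "'i::finite \<Rightarrow> real"
  assumes sym: "\<And>i j. A $ i $ j = A $ j $ i"
    and deg: "\<And>i. deg i = (\<Sum>j\<in>UNIV. A $ i $ j)"
    and d0: "\<And>r. D $ r $ r = 0"
    and step: "\<And>r i j. A $ i $ j * (D $ r $ i - D $ r $ j)\<^sup>2 = A $ i $ j"
    and nbrs: "\<And>r i. (\<Sum>j\<in>UNIV. A $ i $ j * D $ r $ j) =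
      deg i * (D $ r $ i + 1) - (if i = r then 0 else 2)"
    and "CARD('i) \<ge> 2"
  shows "(matrix_inv D *v 1) \<bullet> 1 = 2 / (real CARD('i) - 1)"
proof -
  define n where "n = real CARD('i) - 1"
  have "n \<noteq> 0" using \<open>CARD('i) \<ge> 2\<close> by (simp add: n_def)
  define w where "w i = 2 - deg i" for i
  \<comment> \<open>Each row of \<open>D\<close> serves as the distance function from its own
    root.\<close>
  note sums = sum_degree_and_distance[of A deg "($) (D $ r)" r for r, OF sym deg d0 step nbrs]
  have w: "(\<Sum>i\<in>UNIV. w i) = 2" and Dw: "(\<Sum>i\<in>UNIV. D $ r $ i * w i) = n" for r
    using sums by (simp_all add: w_def n_def)
  \<comment> \<open>This is \<open>(w w^T / n - L) / 2\<close> with the Laplacian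
    \<open>L = diag deg - A\<close>.\<close>
  define B :: "real ^ 'i ^ 'i" where
    "B = (\<chi> i j. (w i * w j / n - (if i = j then deg i else 0) + A $ i $ j) / 2)"
  have "D ** B = mat 1"
  proof -
    have "(\<Sum>k\<in>UNIV. D $ r $ k * B $ k $ j) = (if r = j then 1 else 0)" for r j
    proof -
      have "(\<Sum>k\<in>UNIV. D $ r $ k * B $ k $ j) =
          (\<Sum>k\<in>UNIV. (D $ r $ k * w k * (w j / n)
            - (if k = j then D $ r $ j * deg j else 0) + A $ j $ k * D $ r $ k) / 2)"
        by (intro sum.cong) (auto simp: B_def sym[of _ j] field_simps)
      also have "\<dots> = ((\<Sum>k\<in>UNIV. D $ r $ k * w k) * (w j / n)
            - D $ r $ j * deg j + (\<Sum>k\<in>UNIV. A $ j $ k * D $ r $ k)) / 2"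
        by (simp add: sum_divide_distrib[symmetric] sum.distrib sum_subtractf sum_distrib_right)
      \<comment> \<open>Since \<open>w j + deg j = 2\<close>, the numerator is 2, from which
        \<open>nbrs\<close> subtracts 2 off the diagonal.\<close>
      also have "\<dots> = (if r = j then 1 else 0)"
        unfolding Dw nbrs using \<open>n \<noteq> 0\<close> by (auto simp: w_def field_simps)
      finally show ?thesis .
    qed
    then show ?thesis
      by (simp add: vec_eq_iff matrix_matrix_mult_def mat_def)
  qed
  then have "matrix_inv D = B" by (rule matrix_inv_eqI)
  moreover have "(B *v 1) $ i = w i / n" for i
  proof -
    \<comment> \<open>The last two terms cancel, as rows of the Laplacian sum to 0, and the entries
      of \<open>w\<close> sum to 2.\<close>
    have "(B *v 1) $ i = (w i / n * (\<Sum>j\<in>UNIV. w j) - deg i + (\<Sum>j\<in>UNIV. A $ i $ j)) / 2"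
      by (simp add: matrix_vector_mult_def B_def sum_divide_distrib[symmetric] sum.distrib
          sum_subtractf sum_distrib_left)
    then show ?thesis by (simp add: w deg[symmetric])
  qed
  ultimately show ?thesis
    by (simp add: inner_vec_def sum_divide_distrib[symmetric] w n_def)
qed

section \<open>From the tree to its matrices\<close>

theorem theorem4p1:
  fixes G :: "('a, 'b) pre_digraph"
    and v :: "'i::finite \<Rightarrow> 'a"
    and n :: nat
  assumes "n \<ge> 2"
    and "undirected_tree G"
    and "CARD('i) = n + 1"
    and "bij_betw v UNIV (verts G)"
  shows "(matrix_inv (distance_matrix G v) *v (1 :: real ^ 'i)) \<bullet> 1 = 2 / real n"
proof -
  interpret undirected_tree_graph G
    using assms(2)
    by (auto simp: undirected_tree_def undirected_tree_graph_def undirected_tree_graph_axioms_def)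
  have v: "v i \<in> verts G" for i
    using assms(4) by (auto simp: bij_betw_def)
  have inj: "inj v"
    using assms(4) by (simp add: bij_betw_def)
  \<comment> \<open>This turns row sums weighted by adjacency into the sums over neighbours for
    which the tree lemmas are stated.\<close>
  have reindex: "(\<Sum>j\<in>UNIV. of_bool (v i \<rightarrow>\<^bsub>G\<^esub> v j) * f (v j)) = (\<Sum>l | v i \<rightarrow>\<^bsub>G\<^esub> l. f l)"
    for i and f :: "'a \<Rightarrow> real"
  proof -
    have "(\<Sum>j\<in>UNIV. of_bool (v i \<rightarrow>\<^bsub>G\<^esub> v j) * f (v j)) =
        (\<Sum>l\<in>verts G. of_bool (v i \<rightarrow>\<^bsub>G\<^esub> l) * f l)"
      using assms(4) by (rule sum.reindex_bij_betw)
    also have "\<dots> = (\<Sum>l | v i \<rightarrow>\<^bsub>G\<^esub> l. f l)"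
      by (intro sum.mono_neutral_cong_right) (auto intro: adj_in_verts)
    finally show ?thesis .
  qed
  define A :: "real ^ 'i ^ 'i" where "A = (\<chi> i j. of_bool (v i \<rightarrow>\<^bsub>G\<^esub> v j))"
  define deg where "deg i = (\<Sum>j\<in>UNIV. A $ i $ j)" for i
  have deg: "deg i = card {l. v i \<rightarrow>\<^bsub>G\<^esub> l}" for i
    using reindex[of i "\<lambda>_. 1"] by (simp add: deg_def A_def)
  have "(matrix_inv (distance_matrix G v) *v (1 :: real ^ 'i)) \<bullet> 1 = 2 / (real CARD('i) - 1)"
  proof (rule inner_matrix_inv_distance_one)
    show "A $ i $ j = A $ j $ i" for i j
      using adj_sym by (auto simp: A_def)
    show "deg i = (\<Sum>j\<in>UNIV. A $ i $ j)" for i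
      by (rule deg_def)
    show "distance_matrix G v $ r $ r = 0" for r
      by (simp add: distance_matrix_def graph_dist_refl v)
    show "A $ i $ j * (distance_matrix G v $ r $ i - distance_matrix G v $ r $ j)\<^sup>2 = A $ i $ j"
      for r i j
      by (simp add: A_def distance_matrix_def graph_dist_adj_sq v)
    show "(\<Sum>j\<in>UNIV. A $ i $ j * distance_matrix G v $ r $ j) =
        deg i * (distance_matrix G v $ r $ i + 1) - (if i = r then 0 else 2)" for r i
      using sum_graph_dist_neighbours[OF v v, of r i] reindex[of i "graph_dist G (v r)"]
      by (simp add: A_def distance_matrix_def deg inj_eq[OF inj])
    show "CARD('i) \<ge> 2"
      using assms by simp
  qed
  then show ?thesis
    using assms(3) by simp
qed

end
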